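(* Suppose that a locally compact pair $(X,A)$ is homotopy equivalent to a compact pair and that $(P,Q)$ is a polyhedral pair. Then the relation of homotopy among maps $(X,A)\to(P,Q)$ is open (and, in consequence, closed as well), as a subset of the square of the Polish space of maps $(X,A)\to(P,Q)$.
   Context: A locally compact pair $(X,A)$ is a locally compact Polish space $X$ with a closed subspace $A$; it is a compact pair if $X$ is compact. A map $(X,A)\to(Y,B)$ is a continuous $f:X\to Y$ with $f(A)\subseteq B$; the set of these has the compact-open topology, which is Polish. A homotopy between maps $f,g:(X,A)\to(Y,B)$ is a continuous $h:X\times[0,1]\to Y$ with $h(-,0)=f$, $h(-,1)=g$ and $h(A\times\{t\})\subseteq B$ for all $t$. Homotopy equivalence of pairs is isomorphism in the resulting homotopy category of pairs. A polyhedral pair is a pair homeomorphic to $(|K|,|L|)$, where $K$ is a countable locally finite simplicial complex and $L$ a subcomplex. *)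

theory Defs
  imports "HOL-Analysis.Analysis"
begin

section \<open>Pairs of spaces and their maps\<close>

definition polish_topology :: "'a topology \<Rightarrow> bool" where
  "polish_topology X \<longleftrightarrow> separable_space X \<and> completely_metrizable_space X"

definition locally_compact_pair :: "'a topology \<Rightarrow> 'a set \<Rightarrow> bool" where
  "locally_compact_pair X A \<longleftrightarrow>
     polish_topology X \<and> locally_compact_space X \<and> closedin X A"

definition compact_pair :: "'a topology \<Rightarrow> 'a set \<Rightarrow> bool" where
  "compact_pair X A \<longleftrightarrow> locally_compact_pair X A \<and> compact_space X"

definition pair_map ::
    "'a topology \<Rightarrow> 'a set \<Rightarrow> 'b topology \<Rightarrow> 'b set \<Rightarrow> ('a \<Rightarrow> 'b) \<Rightarrow> bool" where
  "pair_map X A Y B f \<longleftrightarrow> continuous_map X Y f \<and> f ` A \<subseteq> B"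

text \<open>The maps as points of a space: HOL functions are total, so a map out of \<open>X\<close> is represented
  by the function that is \<open>undefined\<close> outside \<open>topspace X\<close>.\<close>

definition pair_maps ::
    "'a topology \<Rightarrow> 'a set \<Rightarrow> 'b topology \<Rightarrow> 'b set \<Rightarrow> ('a \<Rightarrow> 'b) set" where
  "pair_maps X A Y B = {f \<in> extensional (topspace X). pair_map X A Y B f}"

definition map_space ::
    "'a topology \<Rightarrow> 'a set \<Rightarrow> 'b topology \<Rightarrow> 'b set \<Rightarrow> ('a \<Rightarrow> 'b) topology" where
  "map_space X A Y B =
     topology_generated_by
       {{f \<in> pair_maps X A Y B. f ` C \<subseteq> U} | C U. compactin X C \<and> openin Y U}"

lemma topspace_map_space [simp]: "topspace (map_space X A Y B) = pair_maps X A Y B"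
proof -
  have "\<exists>C U. pair_maps X A Y B = {f \<in> pair_maps X A Y B. f ` C \<subseteq> U} \<and> compactin X C \<and> openin Y U"
    by (intro exI[of _ "{}"]) auto
  then show ?thesis
    unfolding map_space_def topology_generated_by_topspace by blast
qed

section \<open>Homotopy of maps of pairs\<close>

text \<open>The library predicate \<^const>\<open>homotopic_with\<close> requires its first argument of every stage
  of the homotopy, and writes the time parameter as the first coordinate.\<close>

definition pair_homotopic ::
    "'a topology \<Rightarrow> 'a set \<Rightarrow> 'b topology \<Rightarrow> 'b set \<Rightarrow> ('a \<Rightarrow> 'b) \<Rightarrow> ('a \<Rightarrow> 'b) \<Rightarrow> bool" where
  "pair_homotopic X A Y B f g \<longleftrightarrow> homotopic_with (\<lambda>k. k ` A \<subseteq> B) X Y f g"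

definition homotopy_equivalent_pair ::
    "'a topology \<Rightarrow> 'a set \<Rightarrow> 'b topology \<Rightarrow> 'b set \<Rightarrow> bool" where
  "homotopy_equivalent_pair X A Y B \<longleftrightarrow>
     (\<exists>f g. pair_map X A Y B f \<and> pair_map Y B X A g \<and>
        pair_homotopic X A X A (g \<circ> f) id \<and> pair_homotopic Y B Y B (f \<circ> g) id)"

definition homotopy_relation ::
    "'a topology \<Rightarrow> 'a set \<Rightarrow> 'b topology \<Rightarrow> 'b set \<Rightarrow> (('a \<Rightarrow> 'b) \<times> ('a \<Rightarrow> 'b)) set" where
  "homotopy_relation X A Y B =
     {(f, g) \<in> pair_maps X A Y B \<times> pair_maps X A Y B. pair_homotopic X A Y B f g}"

section \<open>Polyhedral pairs\<close>

text \<open>An abstract simplicial complex is given by its nonempty simplices; neither it nor a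
  subcomplex has to be nonempty.\<close>

definition abstract_complex :: "'v set set \<Rightarrow> bool" where
  "abstract_complex K \<longleftrightarrow>
     (\<forall>\<sigma>\<in>K. finite \<sigma> \<and> \<sigma> \<noteq> {}) \<and>
     (\<forall>\<sigma>\<in>K. \<forall>\<tau>. \<tau> \<subseteq> \<sigma> \<and> \<tau> \<noteq> {} \<longrightarrow> \<tau> \<in> K)"

definition locally_finite_complex :: "'v set set \<Rightarrow> bool" where
  "locally_finite_complex K \<longleftrightarrow> (\<forall>v. finite {\<sigma> \<in> K. v \<in> \<sigma>})"

text \<open>Points are given by their barycentric coordinates.\<close>

definition closed_simplex :: "'v set \<Rightarrow> ('v \<Rightarrow> real) set" where
  "closed_simplex \<sigma> =
     {x. (\<forall>v. 0 \<le> x v) \<and> (\<forall>v. v \<notin> \<sigma> \<longrightarrow> x v = 0) \<and> (\<Sum>v\<in>\<sigma>. x v) = 1}"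

definition geometric_realization :: "'v set set \<Rightarrow> ('v \<Rightarrow> real) set" where
  "geometric_realization K = (\<Union>\<sigma>\<in>K. closed_simplex \<sigma>)"

text \<open>The weak topology of \<open>|K|\<close>. On a single closed simplex the product topology of
  \<open>'v \<Rightarrow> real\<close> induces the Euclidean one, all but finitely many coordinates being zero.\<close>

definition realization_topology :: "'v set set \<Rightarrow> ('v \<Rightarrow> real) topology" where
  "realization_topology K =
     topology (\<lambda>U. U \<subseteq> geometric_realization K \<and>
       (\<forall>\<sigma>\<in>K. openin (top_of_set (closed_simplex \<sigma>)) (U \<inter> closed_simplex \<sigma>)))"

lemma openin_realization_topology:
  "openin (realization_topology K) U \<longleftrightarrow>
     U \<subseteq> geometric_realization K \<and>
     (\<forall>\<sigma>\<in>K. openin (top_of_set (closed_simplex \<sigma>)) (U \<inter> closed_simplex \<sigma>))"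
proof -
  have "istopology (\<lambda>U. U \<subseteq> geometric_realization K \<and>
     (\<forall>\<sigma>\<in>K. openin (top_of_set (closed_simplex \<sigma>)) (U \<inter> closed_simplex \<sigma>)))"
    unfolding istopology_def
  proof (intro conjI allI impI ballI)
    fix S T :: "('a \<Rightarrow> real) set" and \<sigma>
    assume S: "S \<subseteq> geometric_realization K \<and> (\<forall>\<sigma>\<in>K. openin (top_of_set (closed_simplex \<sigma>)) (S \<inter> closed_simplex \<sigma>))"
      and T: "T \<subseteq> geometric_realization K \<and> (\<forall>\<sigma>\<in>K. openin (top_of_set (closed_simplex \<sigma>)) (T \<inter> closed_simplex \<sigma>))"
    show "S \<inter> T \<subseteq> geometric_realization K" using S by blast
    assume "\<sigma> \<in> K"
    then have "openin (top_of_set (closed_simplex \<sigma>)) (S \<inter> closed_simplex \<sigma>)"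
      and "openin (top_of_set (closed_simplex \<sigma>)) (T \<inter> closed_simplex \<sigma>)"
      using S T by simp_all
    then have "openin (top_of_set (closed_simplex \<sigma>)) ((S \<inter> closed_simplex \<sigma>) \<inter> (T \<inter> closed_simplex \<sigma>))"
      by (rule openin_Int)
    moreover have "(S \<inter> closed_simplex \<sigma>) \<inter> (T \<inter> closed_simplex \<sigma>) = S \<inter> T \<inter> closed_simplex \<sigma>" by blast
    ultimately show "openin (top_of_set (closed_simplex \<sigma>)) (S \<inter> T \<inter> closed_simplex \<sigma>)" by simp
  next
    fix \<U> :: "('a \<Rightarrow> real) set set"
    assume *: "\<forall>U\<in>\<U>. U \<subseteq> geometric_realization K \<and> (\<forall>\<sigma>\<in>K. openin (top_of_set (closed_simplex \<sigma>)) (U \<inter> closed_simplex \<sigma>))"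
    then show "\<Union>\<U> \<subseteq> geometric_realization K" by blast
    fix \<sigma> assume "\<sigma> \<in> K"
    have "openin (top_of_set (closed_simplex \<sigma>)) (\<Union>U\<in>\<U>. U \<inter> closed_simplex \<sigma>)"
      using * \<open>\<sigma> \<in> K\<close> by (intro openin_Union) (simp only: ball_simps bex_simps image_iff, blast)
    moreover have "(\<Union>U\<in>\<U>. U \<inter> closed_simplex \<sigma>) = \<Union>\<U> \<inter> closed_simplex \<sigma>" by blast
    ultimately show "openin (top_of_set (closed_simplex \<sigma>)) (\<Union>\<U> \<inter> closed_simplex \<sigma>)"
      by (rule subst[rotated])
  qed
  then show ?thesis
    unfolding realization_topology_def by (simp only: topology_inverse')
qed

lemma topspace_realization_topology [simp]:
  "topspace (realization_topology K) = geometric_realization K"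
proof -
  have "geometric_realization K \<inter> closed_simplex \<sigma> = closed_simplex \<sigma>" if "\<sigma> \<in> K" for \<sigma>
    using that by (auto simp: geometric_realization_def)
  then have "openin (realization_topology K) (geometric_realization K)"
    by (simp add: openin_realization_topology)
  then show ?thesis
    unfolding topspace_def by (auto simp: openin_realization_topology)
qed

text \<open>The argument \<open>TYPE('v)\<close> names the type from which the vertices are taken.\<close>

definition polyhedral_pair :: "'v itself \<Rightarrow> 'p topology \<Rightarrow> 'p set \<Rightarrow> bool" where
  "polyhedral_pair TYPE('v) P Q \<longleftrightarrow>
     (\<exists>K L :: 'v set set.
        abstract_complex K \<and> countable K \<and> locally_finite_complex K \<and>
        abstract_complex L \<and> L \<subseteq> K \<and>
        (\<exists>h. homeomorphic_map P (realization_topology K) h \<and> Q \<subseteq> topspace P \<and>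
             h ` Q = geometric_realization L))"

end

theory Submission
  imports Defs
begin

text \<open>Points \<open>x\<close> and \<open>y\<close> of \<open>|K|\<close> that lie in a common open vertex star are joined by a path
  through the normalised coordinatewise minimum \<open>z\<close> of \<open>x\<close> and \<open>y\<close>: every closed simplex
  containing \<open>x\<close> or \<open>y\<close> contains \<open>z\<close>, so both straight segments stay in \<open>|K|\<close>, and in \<open>|L|\<close> if
  \<open>x\<close> and \<open>y\<close> lie there. By compactness of \<open>Y\<close>, finitely many conditions of the form
  ``\<open>g ` C\<close> lies in an open star'' on a map \<open>g\<close> of \<open>Y\<close>, all satisfied by \<open>f\<close>, force \<open>f y\<close> and
  \<open>g y\<close> to share a star for all \<open>y\<close>, and hence \<open>f\<close> and \<open>g\<close> to be homotopic. Precomposition with a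
  homotopy equivalence \<open>Y \<rightarrow> X\<close> pulls these conditions back to \<open>X\<close>, so homotopy classes are open.\<close>

section \<open>Closed simplices in barycentric coordinates\<close>

lemma closed_closed_simplex: "closed (closed_simplex \<sigma>)"
proof -
  have "closed_simplex \<sigma> =
      (\<Inter>v. {x. 0 \<le> x v}) \<inter> (\<Inter>v\<in>-\<sigma>. {x. x v = 0}) \<inter> {x. (\<Sum>v\<in>\<sigma>. x v) = 1}"
    by (auto simp: closed_simplex_def)
  then show ?thesis
    by (simp only:) (intro closed_Int closed_INT ballI closed_Collect_le closed_Collect_eq
        continuous_intros continuous_on_product_coordinates)
qed

lemma closed_simplex_convex:
  assumes "x \<in> closed_simplex \<sigma>" "y \<in> closed_simplex \<sigma>" "t \<in> {0..1}"
  shows "(\<lambda>v. (1 - t) * x v + t * y v) \<in> closed_simplex \<sigma>"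
  using assms by (auto simp: closed_simplex_def sum.distrib simp flip: sum_distrib_left)

lemma closed_simplex_nonneg: "x \<in> closed_simplex \<sigma> \<Longrightarrow> 0 \<le> x v"
  by (simp add: closed_simplex_def)

lemma closed_simplex_pos_imp_mem:
  assumes "x \<in> closed_simplex \<sigma>" "0 < x v"
  shows "v \<in> \<sigma>"
  using assms unfolding closed_simplex_def by force

lemma closed_simplex_obtain_pos:
  assumes "x \<in> closed_simplex \<sigma>"
  obtains v where "0 < x v"
proof -
  have "\<exists>v\<in>\<sigma>. x v \<noteq> 0"
  proof (rule ccontr)
    assume "\<not> (\<exists>v\<in>\<sigma>. x v \<noteq> 0)"
    then have "(\<Sum>v\<in>\<sigma>. x v) = 0" by simp
    then show False using assms by (simp add: closed_simplex_def)
  qed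
  then show thesis
    using that closed_simplex_nonneg[OF assms] by (metis less_eq_real_def)
qed

section \<open>The topology of a locally finite realization\<close>

text \<open>The weak topology always contains the subspace topology. Conversely, if
  \<open>x v\<close> is positive, the open half-space \<open>{y. 0 < y v}\<close> meets only closed
  simplices with vertex \<open>v\<close>. There are finitely many of these, so the open conditions
  that they impose near \<open>x\<close> can be intersected.\<close>

lemma realization_topology_eq_top_of_set:
  assumes "locally_finite_complex K"
  shows "realization_topology K = top_of_set (geometric_realization K)"
proof (rule topology_eq[THEN iffD2], intro allI iffI)
  fix U
  assume U: "openin (top_of_set (geometric_realization K)) U"
  then obtain T where T: "open T" "U = geometric_realization K \<inter> T"
    by (auto simp: openin_open)
  have "U \<inter> closed_simplex \<sigma> = closed_simplex \<sigma> \<inter> T" if "\<sigma> \<in> K" for \<sigma>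
    using that T by (auto simp: geometric_realization_def)
  then show "openin (realization_topology K) U"
    using T by (auto simp: openin_realization_topology openin_open_Int)
next
  fix U
  assume U: "openin (realization_topology K) U"
  have "\<exists>T. open T \<and> x \<in> T \<and> geometric_realization K \<inter> T \<subseteq> U" if "x \<in> U" for x
  proof -
    have "x \<in> geometric_realization K"
      using U that by (auto simp: openin_realization_topology)
    then obtain \<tau> where "x \<in> closed_simplex \<tau>"
      by (auto simp: geometric_realization_def)
    then obtain v where v: "0 < x v"
      by (rule closed_simplex_obtain_pos)
    define S where "S = {\<sigma> \<in> K. v \<in> \<sigma>}"
    have "finite S"
      using assms by (simp add: locally_finite_complex_def S_def)
    have "\<exists>T. open T \<and> x \<in> T \<and> closed_simplex \<sigma> \<inter> T \<subseteq> U" if "\<sigma> \<in> S" for \<sigma>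
    proof (cases "x \<in> closed_simplex \<sigma>")
      case True
      have "openin (top_of_set (closed_simplex \<sigma>)) (U \<inter> closed_simplex \<sigma>)"
        using U that by (auto simp: openin_realization_topology S_def)
      then obtain T where "open T" "U \<inter> closed_simplex \<sigma> = closed_simplex \<sigma> \<inter> T"
        by (auto simp: openin_open)
      then show ?thesis
        using True \<open>x \<in> U\<close> by blast
    next
      case False
      then show ?thesis
        \<comment> \<open>A neighbourhood of \<open>x\<close> that avoids this closed simplex makes
          its condition vacuous.\<close>
        using closed_closed_simplex[of \<sigma>] by (intro exI[of _ "- closed_simplex \<sigma>"]) auto
    qed
    then obtain T where
      T: "\<And>\<sigma>. \<sigma> \<in> S \<Longrightarrow> open (T \<sigma>) \<and> x \<in> T \<sigma> \<and> closed_simplex \<sigma> \<inter> T \<sigma> \<subseteq> U"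
      by metis
    define W where "W = {y. 0 < y v} \<inter> (\<Inter>\<sigma>\<in>S. T \<sigma>)"
    have "open {y :: 'a \<Rightarrow> real. 0 < y v}"
      by (intro open_Collect_less continuous_intros continuous_on_product_coordinates)
    then have "open W"
      unfolding W_def using T \<open>finite S\<close> by (intro open_Int open_INT) auto
    moreover have "x \<in> W"
      using v T by (auto simp: W_def)
    moreover have "geometric_realization K \<inter> W \<subseteq> U"
    proof
      fix y
      assume y: "y \<in> geometric_realization K \<inter> W"
      then obtain \<sigma> where "\<sigma> \<in> K" "y \<in> closed_simplex \<sigma>"
        by (auto simp: geometric_realization_def)
      with y have "\<sigma> \<in> S"
        using closed_simplex_pos_imp_mem by (force simp: S_def W_def)
      with y \<open>y \<in> closed_simplex \<sigma>\<close> show "y \<in> U"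
        using T by (auto simp: W_def)
    qed
    ultimately show ?thesis
      by blast
  qed
  moreover have "U \<subseteq> geometric_realization K"
    using U by (auto simp: openin_realization_topology)
  ultimately show "openin (top_of_set (geometric_realization K)) U"
    by (subst openin_subopen) (metis Int_iff inf_le1 openin_open_Int subset_iff)
qed

text \<open>Local finiteness turns continuity into the weak topology into a condition on
  coordinates, so that homotopies can be given by formulas.\<close>

lemma continuous_map_realization_iff:
  assumes "locally_finite_complex K"
  shows "continuous_map Z (realization_topology K) f \<longleftrightarrow>
    f ` topspace Z \<subseteq> geometric_realization K \<and>
    (\<forall>v. continuous_map Z euclideanreal (\<lambda>z. f z v))"
  unfolding realization_topology_eq_top_of_set[OF assms]
  by (auto simp: continuous_map_in_subtopology euclidean_product_topology[symmetric]
      continuous_map_componentwise_UNIV)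

section \<open>Homotopies in the realization\<close>

text \<open>By convexity the segment from \<open>f y\<close> to \<open>m y\<close> stays in each
  closed simplex containing \<open>f y\<close>. The hypothesis on \<open>m\<close> concerns all
  \<sigma>, so it serves \<open>K\<close> and \<open>L\<close> at once.\<close>

lemma pair_homotopic_straight_line:
  assumes "locally_finite_complex K" "L \<subseteq> K" "B \<subseteq> topspace Y"
    and f: "pair_map Y B (realization_topology K) (geometric_realization L) f"
    and m: "\<And>v. continuous_map Y euclideanreal (\<lambda>y. m y v)"
    and simplex: "\<And>y \<sigma>. y \<in> topspace Y \<Longrightarrow> f y \<in> closed_simplex \<sigma> \<Longrightarrow> m y \<in> closed_simplex \<sigma>"
  shows "pair_homotopic Y B (realization_topology K) (geometric_realization L) f m"
proof -
  define h where "h = (\<lambda>(t::real, y) v. (1 - t) * f y v + t * m y v)"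
  have f_coord: "continuous_map Y euclideanreal (\<lambda>y. f y v)" for v
    using f assms(1) by (auto simp: pair_map_def continuous_map_realization_iff)
  have h_simplex: "h (t, y) \<in> closed_simplex \<sigma>"
    if "t \<in> {0..1}" "y \<in> topspace Y" "f y \<in> closed_simplex \<sigma>" for t y \<sigma>
    using closed_simplex_convex[OF that(3) simplex[OF that(2,3)] that(1)] by (simp add: h_def)
  \<comment> \<open>\<open>M\<close> will be \<open>K\<close> for the target of the homotopy and
    \<open>L\<close> for its values on \<open>B\<close>.\<close>
  have h_in: "h (t, y) \<in> geometric_realization M"
    if "t \<in> {0..1}" "y \<in> topspace Y" "f y \<in> geometric_realization M" for t y M
    using that h_simplex unfolding geometric_realization_def by blast
  let ?Z = "prod_topology (top_of_set {0..1::real}) Y"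
  have snd: "continuous_map ?Z Y snd"
    by (rule continuous_map_snd)
  have fst: "continuous_map ?Z euclideanreal fst"
    using continuous_map_fst continuous_map_into_fulltopology by blast
  have "continuous_map ?Z euclideanreal (\<lambda>z. h z v)" for v
  proof -
    have "continuous_map ?Z euclideanreal (\<lambda>z. (1 - fst z) * f (snd z) v + fst z * m (snd z) v)"
      using continuous_map_compose[OF snd f_coord[of v]] continuous_map_compose[OF snd m[of v]]
      by (intro continuous_map_add continuous_map_real_mult continuous_map_diff fst) (auto simp: o_def)
    then show ?thesis
      by (simp add: h_def case_prod_unfold)
  qed
  moreover have "h ` topspace ?Z \<subseteq> geometric_realization K"
    using f h_in[where M = K] by (auto simp: pair_map_def dest!: continuous_map_image_subset_topspace)
  ultimately have "continuous_map ?Z (realization_topology K) h"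
    using assms(1) by (simp add: continuous_map_realization_iff)
  moreover have "(\<lambda>y. h (t, y)) ` B \<subseteq> geometric_realization L" if "t \<in> {0..1}" for t
    using that assms(3) f h_in[where M = L] by (auto simp: pair_map_def image_subset_iff subset_iff)
  ultimately show ?thesis
    unfolding pair_homotopic_def homotopic_with_def
    by (intro exI[of _ h]) (auto simp: h_def)
qed

text \<open>The minimum vanishes wherever \<open>x\<close> does, hence outside \<sigma>. Dividing by
  a sum over \<open>F\<close> rather than \<sigma> keeps the formula independent of the simplex; the
  common positive coordinate \<open>v\<close> lies in \<open>F\<close> and makes the divisor
  positive.\<close>

lemma normalized_min_in_closed_simplex:
  fixes x y :: "'v \<Rightarrow> real"
  assumes x: "x \<in> closed_simplex \<sigma>" and "finite \<sigma>" "\<And>v. 0 \<le> y v"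
    and v: "0 < x v" "0 < y v"
    and F: "finite F" "\<And>w. w \<notin> F \<Longrightarrow> min (x w) (y w) = 0"
  shows "(\<lambda>w. min (x w) (y w) / (\<Sum>w\<in>F. min (x w) (y w))) \<in> closed_simplex \<sigma>"
proof -
  have nonneg: "0 \<le> min (x w) (y w)" for w
    using assms closed_simplex_nonneg[OF x] by simp
  have "v \<in> F"
    using F(2)[of v] v by (metis less_irrefl min_less_iff_conj)
  then have "0 < (\<Sum>w\<in>F. min (x w) (y w))"
    using v nonneg F(1) by (intro sum_pos2[of F v]) auto
  \<comment> \<open>Both sums reduce to \<open>\<sigma> \<inter> F\<close>: the minimum is zero off
    \<sigma> because \<open>x\<close> is, and off \<open>F\<close> by assumption.\<close>
  moreover have "(\<Sum>w\<in>\<sigma>. min (x w) (y w)) = (\<Sum>w\<in>F. min (x w) (y w))"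
    using assms x by (intro sum.mono_neutral_cong) (auto simp: closed_simplex_def)
  ultimately show ?thesis
    using x assms(3) by (auto simp: closed_simplex_def simp flip: sum_divide_distrib)
qed

text \<open>The homotopy passes through the normalised minimum because a common star need not give a
  common simplex, so a direct segment from \<open>f y\<close> to \<open>g y\<close> could leave
  |K|.\<close>

lemma pair_homotopic_if_common_star:
  fixes K :: "'v set set"
  assumes K: "abstract_complex K" "locally_finite_complex K" and "L \<subseteq> K" "B \<subseteq> topspace Y"
    and f: "pair_map Y B (realization_topology K) (geometric_realization L) f"
    and g: "pair_map Y B (realization_topology K) (geometric_realization L) g"
    and star: "\<And>y. y \<in> topspace Y \<Longrightarrow> \<exists>v\<in>V. 0 < f y v \<and> 0 < g y v"
    and "finite V"
  shows "pair_homotopic Y B (realization_topology K) (geometric_realization L) f g"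
proof -
  \<comment> \<open>The vertices of all simplices that have a vertex in \<open>V\<close>. They
    include the support of every \<open>f y\<close>, so one fixed finite sum normalises all the
    minima and depends continuously on \<open>y\<close>.\<close>
  define F where "F = \<Union> (\<Union>v\<in>V. {\<sigma> \<in> K. v \<in> \<sigma>})"
  have "finite F"
    using K \<open>finite V\<close>
    by (auto simp: F_def abstract_complex_def locally_finite_complex_def)
  define m where "m = (\<lambda>y w. min (f y w) (g y w) / (\<Sum>w\<in>F. min (f y w) (g y w)))"
  have in_simplex: "\<exists>\<sigma>\<in>K. k y \<in> closed_simplex \<sigma>"
    if "pair_map Y B (realization_topology K) (geometric_realization L) k" "y \<in> topspace Y" for k y
    using that by (auto simp: pair_map_def continuous_map_def geometric_realization_def)
  have nonneg: "0 \<le> f y w" "0 \<le> g y w" if "y \<in> topspace Y" for y w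
    using in_simplex[OF f that] in_simplex[OF g that] by (auto intro: closed_simplex_nonneg)
  have coord: "continuous_map Y euclideanreal (\<lambda>y. f y v)"
    "continuous_map Y euclideanreal (\<lambda>y. g y v)" for v
    using f g K by (auto simp: pair_map_def continuous_map_realization_iff)
  have supp: "min (f y w) (g y w) = 0" if y: "y \<in> topspace Y" and "w \<notin> F" for y w
  proof -
    obtain v where "v \<in> V" "0 < f y v"
      using star[OF y] by blast
    moreover obtain \<sigma> where "\<sigma> \<in> K" "f y \<in> closed_simplex \<sigma>"
      using in_simplex[OF f y] by blast
    ultimately have "w \<notin> \<sigma>"
      using \<open>w \<notin> F\<close> closed_simplex_pos_imp_mem[of "f y" \<sigma> v] by (auto simp: F_def)
    then have "f y w = 0"
      using \<open>f y \<in> closed_simplex \<sigma>\<close> by (simp add: closed_simplex_def)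
    then show ?thesis
      using nonneg[OF y, of w] by simp
  qed
  \<comment> \<open>A sum over an infinite set is 0 by default, hence not 1, so the closed simplex
    on an infinite set is empty.\<close>
  have finite_simplex: "finite \<sigma>" if "x \<in> closed_simplex \<sigma>" for \<sigma> and x :: "'v \<Rightarrow> real"
  proof (rule ccontr)
    assume "infinite \<sigma>"
    then show False
      using that by (simp add: closed_simplex_def)
  qed
  have m_f: "m y \<in> closed_simplex \<sigma>" if y: "y \<in> topspace Y" "f y \<in> closed_simplex \<sigma>" for y \<sigma>
  proof -
    obtain v where "0 < f y v" "0 < g y v"
      using star[OF y(1)] by blast
    then show ?thesis
      unfolding m_def
      using y nonneg supp \<open>finite F\<close> finite_simplex
      by (intro normalized_min_in_closed_simplex) auto
  qed
  \<comment> \<open>The minimum is symmetric, so exchanging \<open>f\<close> and \<open>g\<close>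
    leaves \<open>m y\<close> unchanged.\<close>
  have m_g: "m y \<in> closed_simplex \<sigma>" if y: "y \<in> topspace Y" "g y \<in> closed_simplex \<sigma>" for y \<sigma>
  proof -
    obtain v where "0 < f y v" "0 < g y v"
      using star[OF y(1)] by blast
    then show ?thesis
      unfolding m_def min.commute[of "f y _"]
      using y nonneg supp \<open>finite F\<close> finite_simplex
      by (intro normalized_min_in_closed_simplex) (auto simp: min.commute)
  qed
  \<comment> \<open>Division by zero yields 0, so a vanishing divisor would make \<open>m y\<close>
    the zero function, which lies in no closed simplex.\<close>
  have sum_nz: "(\<Sum>w\<in>F. min (f y w) (g y w)) \<noteq> 0" if y: "y \<in> topspace Y" for y
  proof
    assume "(\<Sum>w\<in>F. min (f y w) (g y w)) = 0"
    then have "m y v = 0" for v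
      by (simp add: m_def)
    moreover obtain \<sigma> where "m y \<in> closed_simplex \<sigma>"
      using in_simplex[OF f y] m_f[OF y] by blast
    ultimately show False
      using closed_simplex_obtain_pos by (metis less_irrefl)
  qed
  have m_cont: "continuous_map Y euclideanreal (\<lambda>y. m y v)" for v
    unfolding m_def
    by (intro continuous_map_real_divide continuous_map_sum continuous_map_real_min coord
        \<open>finite F\<close> sum_nz)
  have "pair_homotopic Y B (realization_topology K) (geometric_realization L) f m"
    by (rule pair_homotopic_straight_line) (use assms m_cont m_f in auto)
  moreover have "pair_homotopic Y B (realization_topology K) (geometric_realization L) g m"
    by (rule pair_homotopic_straight_line) (use assms m_cont m_g in auto)
  ultimately show ?thesis
    unfolding pair_homotopic_def by (meson homotopic_with_sym homotopic_with_trans)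
qed

section \<open>Maps from a compact pair to a polyhedral pair\<close>

text \<open>The neighbourhood of \<open>f\<close> is kept as a finite list of conditions, so that it
  can later be moved to another space by taking images of the sets \<open>C\<close>. It speaks of
  \<open>pair_map\<close> because composites, which need not be extensional, will be put for
  \<open>g\<close>.\<close>

lemma polyhedral_pair_homotopic_nearby:
  fixes f :: "'b \<Rightarrow> 'p"
  assumes "polyhedral_pair TYPE('v) P Q" "compact_space Y" "B \<subseteq> topspace Y" "pair_map Y B P Q f"
  obtains I where "finite I"
    and "\<And>C U. (C, U) \<in> I \<Longrightarrow> compactin Y C \<and> openin P U \<and> f ` C \<subseteq> U"
    and "\<And>g. pair_map Y B P Q g \<Longrightarrow> (\<And>C U. (C, U) \<in> I \<Longrightarrow> g ` C \<subseteq> U) \<Longrightarrow> pair_homotopic Y B P Q f g"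
proof -
  obtain K L :: "'v set set" and h where
    K: "abstract_complex K" "locally_finite_complex K" "L \<subseteq> K"
    and h: "homeomorphic_map P (realization_topology K) h"
    and Q: "Q \<subseteq> topspace P" "h ` Q = geometric_realization L"
    using assms(1) unfolding polyhedral_pair_def by blast
  obtain h' where h': "homeomorphic_maps P (realization_topology K) h h'"
    using h homeomorphic_map_maps by blast
  have h'h: "h' (h p) = p" if "p \<in> topspace P" for p
    using h' that by (simp add: homeomorphic_maps_def)
  have h'_map: "pair_map (realization_topology K) (geometric_realization L) P Q h'"
    using h' Q h'h unfolding pair_map_def homeomorphic_maps_def
    by (auto simp flip: Q(2))
  have h_comp: "pair_map Y B (realization_topology K) (geometric_realization L) (h \<circ> k)"
    if "pair_map Y B P Q k" for k
    using that h' Q unfolding pair_map_def homeomorphic_maps_def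
    by (auto intro: continuous_map_compose simp flip: Q(2))
  have coord: "continuous_map P euclideanreal (\<lambda>p. h p v)" for v
    using h' K by (auto simp: homeomorphic_maps_def continuous_map_realization_iff)
  have fY: "f y \<in> topspace P" if "y \<in> topspace Y" for y
    using assms(4) that by (auto simp: pair_map_def continuous_map_def)
  \<comment> \<open>The open star of the vertex \<open>v\<close>, pulled back to
    \<open>P\<close>.\<close>
  define star where "star v = {p \<in> topspace P. 0 < h p v}" for v
  have star_open: "openin P (star v)" for v
    using openin_continuous_map_preimage[OF coord[of v], of "{0<..}"] by (simp add: star_def)
  have "\<exists>v. 0 < h (f y) v" if "y \<in> topspace Y" for y
  proof -
    have "h (f y) \<in> geometric_realization K"
      using h' fY[OF that] by (auto simp: homeomorphic_maps_def continuous_map_def)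
    then show ?thesis
      unfolding geometric_realization_def using closed_simplex_obtain_pos by (metis UN_E)
  qed
  then obtain v where v: "\<And>y. y \<in> topspace Y \<Longrightarrow> 0 < h (f y) (v y)"
    by metis
  \<comment> \<open>Halving the positive value at \<open>y\<close> leaves room for two sets: the
    open \<open>O' y\<close> contains \<open>y\<close> and serves for covering, while the larger
    closed, hence compact, \<open>C y\<close> is still mapped into the star of \<open>v y\<close> by
    \<open>f\<close>.\<close>
  define O' where "O' y = {z \<in> topspace Y. h (f y) (v y) / 2 < h (f z) (v y)}" for y
  define C where "C y = {z \<in> topspace Y. h (f y) (v y) / 2 \<le> h (f z) (v y)}" for y
  have coord_f: "continuous_map Y euclideanreal (\<lambda>z. h (f z) w)" for w
    using continuous_map_compose[OF _ coord[of w], of Y f] assms(4) by (simp add: pair_map_def o_def)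
  have "openin Y (O' y)" for y
    using openin_continuous_map_preimage[OF coord_f[of "v y"], of "{h (f y) (v y) / 2<..}"]
    by (simp add: O'_def)
  moreover have "topspace Y \<subseteq> \<Union> (O' ` topspace Y)"
    using v by (force simp: O'_def)
  ultimately have "\<exists>\<F>. finite \<F> \<and> \<F> \<subseteq> O' ` topspace Y \<and> topspace Y \<subseteq> \<Union>\<F>"
    using assms(2) unfolding compact_space_alt by (metis (no_types, lifting) imageE)
  then obtain D where D: "finite D" "D \<subseteq> topspace Y" "topspace Y \<subseteq> \<Union> (O' ` D)"
    by (metis finite_subset_image)
  have C_compact: "compactin Y (C y)" for y
    using closedin_continuous_map_preimage[OF coord_f[of "v y"], of "{h (f y) (v y) / 2..}"] assms(2)
    by (intro closedin_compact_space) (simp_all add: C_def)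
  have C_star: "f ` C y \<subseteq> star (v y)" if "y \<in> D" for y
  proof -
    have "0 < h (f y) (v y)"
      using v D that by blast
    then show ?thesis
      using fY by (fastforce simp: C_def star_def)
  qed
  show thesis
  proof (rule that[of "(\<lambda>y. (C y, star (v y))) ` D"])
    show "finite ((\<lambda>y. (C y, star (v y))) ` D)"
      using D by simp
    show "compactin Y C' \<and> openin P U \<and> f ` C' \<subseteq> U"
      if "(C', U) \<in> (\<lambda>y. (C y, star (v y))) ` D" for C' U
      using that C_compact C_star star_open by auto
    fix g
    assume g: "pair_map Y B P Q g"
      and gC: "\<And>C' U. (C', U) \<in> (\<lambda>y. (C y, star (v y))) ` D \<Longrightarrow> g ` C' \<subseteq> U"
    have gY: "g y \<in> topspace P" if "y \<in> topspace Y" for y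
      using g that by (auto simp: pair_map_def continuous_map_def)
    \<comment> \<open>The sets \<open>O' y\<close> with \<open>y\<close> in \<open>D\<close> cover
      \<open>Y\<close>, and on \<open>C y\<close> both maps take values in the star of
      \<open>v y\<close>.\<close>
    have common: "\<exists>w\<in>v ` D. 0 < (h \<circ> f) z w \<and> 0 < (h \<circ> g) z w" if z: "z \<in> topspace Y" for z
    proof -
      obtain y where y: "y \<in> D" "z \<in> O' y"
        using D z by blast
      then have "z \<in> C y"
        by (auto simp: O'_def C_def)
      then have "f z \<in> star (v y)" "g z \<in> star (v y)"
        using C_star gC y by blast+
      then show ?thesis
        using y by (auto simp: star_def)
    qed
    have hfg: "pair_homotopic Y B (realization_topology K) (geometric_realization L) (h \<circ> f) (h \<circ> g)"
      using pair_homotopic_if_common_star[OF K assms(3) h_comp[OF assms(4)] h_comp[OF g] common] D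
      by blast
    have "pair_homotopic Y B P Q (h' \<circ> (h \<circ> f)) (h' \<circ> (h \<circ> g))"
      unfolding pair_homotopic_def
      by (rule homotopic_with_compose_continuous_map_left[OF hfg[unfolded pair_homotopic_def]])
        (use h'_map in \<open>auto simp: pair_map_def\<close>)
    \<comment> \<open>\<open>h' \<circ> h\<close> is known to be the identity only on
      \<open>topspace P\<close>, so the composites are compared with \<open>f\<close> and
      \<open>g\<close> on \<open>topspace Y\<close>.\<close>
    then show "pair_homotopic Y B P Q f g"
      unfolding pair_homotopic_def
      by (rule homotopic_with_eq) (use fY gY h'h assms(3) in \<open>auto simp: image_subset_iff subset_iff\<close>)
  qed
qed

section \<open>Homotopy equivalences and the compact-open topology\<close>

text \<open>The chain runs from \<open>f\<close> to \<open>f \<circ> \<phi> \<circ> \<psi>\<close>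
  to \<open>g \<circ> \<phi> \<circ> \<psi>\<close> to \<open>g\<close>. Its outer links compose the
  homotopy from \<open>\<phi> \<circ> \<psi>\<close> to \<open>id\<close> with \<open>f\<close> and
  \<open>g\<close>; the middle one precomposes with \<psi>.\<close>

lemma pair_homotopic_if_precompose:
  assumes \<psi>: "pair_map X A Y B \<psi>" and \<phi>: "pair_homotopic X A X A (\<phi> \<circ> \<psi>) id"
    and f: "pair_map X A P Q f" and g: "pair_map X A P Q g"
    and fg: "pair_homotopic Y B P Q (f \<circ> \<phi>) (g \<circ> \<phi>)"
  shows "pair_homotopic X A P Q f g"
proof -
  have post: "pair_homotopic X A P Q (k \<circ> (\<phi> \<circ> \<psi>)) (k \<circ> id)" if "pair_map X A P Q k" for k
    unfolding pair_homotopic_def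
    by (rule homotopic_with_compose_continuous_map_left[OF \<phi>[unfolded pair_homotopic_def]])
      (use that in \<open>auto simp: pair_map_def\<close>)
  have "pair_homotopic X A P Q ((f \<circ> \<phi>) \<circ> \<psi>) ((g \<circ> \<phi>) \<circ> \<psi>)"
    unfolding pair_homotopic_def
    by (rule homotopic_with_compose_continuous_map_right[OF fg[unfolded pair_homotopic_def]])
      (use \<psi> in \<open>auto simp: pair_map_def\<close>)
  with post[OF f] post[OF g] show ?thesis
    unfolding pair_homotopic_def comp_assoc comp_id
    by (meson homotopic_with_sym homotopic_with_trans)
qed

lemma openin_map_space_subbasic:
  assumes "compactin X C" "openin Y U"
  shows "openin (map_space X A Y B) {f \<in> pair_maps X A Y B. f ` C \<subseteq> U}"
  unfolding map_space_def
  by (rule topology_generated_by_Basis) (use assms in blast)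

lemma openin_map_space_finite:
  assumes "finite I" "\<And>C U. (C, U) \<in> I \<Longrightarrow> compactin X C \<and> openin Y U"
  shows "openin (map_space X A Y B) {f \<in> pair_maps X A Y B. \<forall>(C, U)\<in>I. f ` C \<subseteq> U}"
  using assms
proof (induction I rule: finite_induct)
  case empty
  then show ?case
    using openin_topspace[of "map_space X A Y B"] by simp
next
  case (insert i I)
  obtain C U where i: "i = (C, U)" by fastforce
  have "openin (map_space X A Y B)
      ({f \<in> pair_maps X A Y B. f ` C \<subseteq> U} \<inter> {f \<in> pair_maps X A Y B. \<forall>(C, U)\<in>I. f ` C \<subseteq> U})"
    using insert i by (intro openin_Int openin_map_space_subbasic) auto
  moreover have "{f \<in> pair_maps X A Y B. f ` C \<subseteq> U} \<inter> {f \<in> pair_maps X A Y B. \<forall>(C, U)\<in>I. f ` C \<subseteq> U}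
      = {f \<in> pair_maps X A Y B. \<forall>(C, U)\<in>insert i I. f ` C \<subseteq> U}"
    using i by auto
  ultimately show ?case by simp
qed

text \<open>Maps \<open>g\<close> close to \<open>f\<close> have \<open>g \<circ> \<phi>\<close>
  close to \<open>f \<circ> \<phi>\<close> on the compact pair, where closeness gives a homotopy;
  this one descends to \<open>f\<close> and \<open>g\<close>.\<close>

lemma open_homotopy_neighbourhood:
  assumes "compact_pair Y B" "homotopy_equivalent_pair X A Y B" "polyhedral_pair TYPE('v) P Q"
    and f: "f \<in> pair_maps X A P Q"
  obtains N where "openin (map_space X A P Q) N" "f \<in> N"
    "\<And>g. g \<in> N \<Longrightarrow> pair_homotopic X A P Q f g"
proof -
  obtain \<psi> \<phi> where \<psi>: "pair_map X A Y B \<psi>" and \<phi>: "pair_map Y B X A \<phi>"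
    and \<phi>\<psi>: "pair_homotopic X A X A (\<phi> \<circ> \<psi>) id"
    using assms(2) unfolding homotopy_equivalent_pair_def by blast
  have Y: "compact_space Y" "B \<subseteq> topspace Y"
    using assms(1) closedin_subset by (auto simp: compact_pair_def locally_compact_pair_def)
  have comp: "pair_map Y B P Q (k \<circ> \<phi>)" if "k \<in> pair_maps X A P Q" for k
    using that \<phi> unfolding pair_maps_def pair_map_def
    by (auto intro: continuous_map_compose)
  obtain I where I: "finite I"
    "\<And>C U. (C, U) \<in> I \<Longrightarrow> compactin Y C \<and> openin P U \<and> (f \<circ> \<phi>) ` C \<subseteq> U"
    "\<And>g. pair_map Y B P Q g \<Longrightarrow> (\<And>C U. (C, U) \<in> I \<Longrightarrow> g ` C \<subseteq> U) \<Longrightarrow> pair_homotopic Y B P Q (f \<circ> \<phi>) g"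
    using polyhedral_pair_homotopic_nearby[OF assms(3) Y comp[OF f]] by metis
  define J where "J = (\<lambda>(C, U). (\<phi> ` C, U)) ` I"
  show thesis
  proof (rule that[of "{g \<in> pair_maps X A P Q. \<forall>(C, U)\<in>J. g ` C \<subseteq> U}"])
    show "openin (map_space X A P Q) {g \<in> pair_maps X A P Q. \<forall>(C, U)\<in>J. g ` C \<subseteq> U}"
      using I \<phi> by (intro openin_map_space_finite) (auto simp: J_def pair_map_def intro: image_compactin)
    show "f \<in> {g \<in> pair_maps X A P Q. \<forall>(C, U)\<in>J. g ` C \<subseteq> U}"
      using I f by (fastforce simp: J_def image_comp)
    fix g
    assume g: "g \<in> {g \<in> pair_maps X A P Q. \<forall>(C, U)\<in>J. g ` C \<subseteq> U}"
    have "(g \<circ> \<phi>) ` C \<subseteq> U" if "(C, U) \<in> I" for C U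
      using g that by (force simp: J_def)
    then have "pair_homotopic Y B P Q (f \<circ> \<phi>) (g \<circ> \<phi>)"
      using g by (intro I(3) comp) auto
    then show "pair_homotopic X A P Q f g"
      using f g by (intro pair_homotopic_if_precompose[OF \<psi> \<phi>\<psi>]) (auto simp: pair_maps_def)
  qed
qed

section \<open>Openness and closedness of the homotopy relation\<close>

theorem lemma4p4:
  fixes X :: "'a topology" and A :: "'a set"
    and Y :: "'b topology" and B :: "'b set"
    and P :: "'p topology" and Q :: "'p set"
  assumes "locally_compact_pair X A"
    and "compact_pair Y B"
    and "homotopy_equivalent_pair X A Y B"
    and "polyhedral_pair TYPE('v) P Q"
  shows "openin (prod_topology (map_space X A P Q) (map_space X A P Q)) (homotopy_relation X A P Q)
       \<and> closedin (prod_topology (map_space X A P Q) (map_space X A P Q)) (homotopy_relation X A P Q)"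
proof -
  let ?M = "map_space X A P Q" and ?R = "homotopy_relation X A P Q"
  let ?T = "pair_maps X A P Q"
  \<comment> \<open>On a product of neighbourhoods inside two homotopy classes the truth value of
    the relation is constant. The value true will give openness, the value false closedness.\<close>
  have box: "\<exists>N N'. openin ?M N \<and> openin ?M N' \<and> f \<in> N \<and> g \<in> N' \<and>
      (\<forall>f'\<in>N. \<forall>g'\<in>N'. pair_homotopic X A P Q f' g' \<longleftrightarrow> pair_homotopic X A P Q f g)"
    if f: "f \<in> ?T" and g: "g \<in> ?T" for f g
  proof -
    obtain N where N: "openin ?M N" "f \<in> N" "\<And>k. k \<in> N \<Longrightarrow> pair_homotopic X A P Q f k"
      using open_homotopy_neighbourhood[OF assms(2-4) f] by blast
    obtain N' where N': "openin ?M N'" "g \<in> N'" "\<And>k. k \<in> N' \<Longrightarrow> pair_homotopic X A P Q g k"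
      using open_homotopy_neighbourhood[OF assms(2-4) g] by blast
    have "pair_homotopic X A P Q f' g' \<longleftrightarrow> pair_homotopic X A P Q f g"
      if "f' \<in> N" "g' \<in> N'" for f' g'
      using N(3)[OF that(1)] N'(3)[OF that(2)] unfolding pair_homotopic_def
      by (meson homotopic_with_sym homotopic_with_trans)
    with N N' show ?thesis by blast
  qed
  have sub: "N \<subseteq> ?T" if "openin ?M N" for N
    using openin_subset[OF that] by simp
  have "openin (prod_topology ?M ?M) ?R"
    unfolding openin_prod_topology_alt
  proof (intro allI impI)
    fix f g
    assume "(f, g) \<in> ?R"
    then have fg: "f \<in> ?T" "g \<in> ?T" "pair_homotopic X A P Q f g"
      by (auto simp: homotopy_relation_def)
    then obtain N N' where "openin ?M N" "openin ?M N'" "f \<in> N" "g \<in> N'"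
      "\<forall>f'\<in>N. \<forall>g'\<in>N'. pair_homotopic X A P Q f' g'"
      using box[OF fg(1,2)] by blast
    then show "\<exists>U V. openin ?M U \<and> openin ?M V \<and> f \<in> U \<and> g \<in> V \<and> U \<times> V \<subseteq> ?R"
      using sub unfolding homotopy_relation_def by blast
  qed
  moreover have "openin (prod_topology ?M ?M) (topspace (prod_topology ?M ?M) - ?R)"
    unfolding openin_prod_topology_alt
  proof (intro allI impI)
    fix f g
    assume "(f, g) \<in> topspace (prod_topology ?M ?M) - ?R"
    then have fg: "f \<in> ?T" "g \<in> ?T" "\<not> pair_homotopic X A P Q f g"
      by (auto simp: homotopy_relation_def)
    then obtain N N' where N: "openin ?M N" "openin ?M N'" "f \<in> N" "g \<in> N'"
      "\<forall>f'\<in>N. \<forall>g'\<in>N'. \<not> pair_homotopic X A P Q f' g'"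
      using box[OF fg(1,2)] by blast
    \<comment> \<open>The same boxes, now with the value false, fill the complement.\<close>
    moreover have "N \<times> N' \<subseteq> topspace (prod_topology ?M ?M) - ?R"
      using N sub by (fastforce simp: homotopy_relation_def)
    ultimately show "\<exists>U V. openin ?M U \<and> openin ?M V \<and> f \<in> U \<and> g \<in> V \<and>
        U \<times> V \<subseteq> topspace (prod_topology ?M ?M) - ?R"
      by blast
  qed
  moreover have "?R \<subseteq> topspace (prod_topology ?M ?M)"
    by (auto simp: homotopy_relation_def)
  ultimately show ?thesis
    by (simp add: closedin_def)
qed

end
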